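(* Let $t_0<t_1$ be real numbers, let $X$ be a Banach space, let $0<\alpha<1$, $1<p<\infty$, and $p^*=p/(p-1)$. (i) If $\alpha>1/p^*$, then $$N_{\alpha,p}\le\frac{(t_1-t_0)^\alpha}{\Gamma(\alpha)\big[(\alpha-1)p+1\big]^{1/p}\big(\alpha p^*\big)^{1/p^*}}.$$ Moreover, if $p<p_{1,\alpha}$, then $$\frac{(t_1-t_0)^\alpha}{\Gamma(\alpha)\big[(\alpha-1)p+1\big]^{1/p}\big(\alpha p^*\big)^{1/p^*}}<\frac{(t_1-t_0)^\alpha}{\Gamma(\alpha+1)}.$$ Otherwise, i.e., when $p\ge p_{1,\alpha}$, one cannot improve the bound (B) by means of the estimates (E), where (B) and (E) are described in the context. (ii) If $\alpha>1/p$, then $$N_{\alpha,p}\le\frac{(t_1-t_0)^\alpha}{\Gamma(\alpha)\big[(\alpha-1)p^*+1\big]^{1/p^*}\big(\alpha p\big)^{1/p}}.$$ Moreover, if $p>p_{2,\alpha}$, then $$\frac{(t_1-t_0)^\alpha}{\Gamma(\alpha)\big[(\alpha-1)p^*+1\big]^{1/p^*}\big(\alpha p\big)^{1/p}}<\frac{(t_1-t_0)^\alpha}{\Gamma(\alpha+1)}.$$ Otherwise, i.e., when $p\le p_{2,\alpha}$, one cannot improve the bound (B) by means of the estimates (E).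
   Context: $L^p(t_0,t_1;X)$ is the Bochner-Lebesgue space on $[t_0,t_1]$ with its usual norm. For $\alpha>0$, $J^\alpha_{t_0,t}$ is the bounded linear operator from $L^p(t_0,t_1;X)$ into itself sending $f$ to the (a.e. defined) function $t\mapsto J^\alpha_{t_0,t}f(t):=\frac{1}{\Gamma(\alpha)}\int_{t_0}^t(t-s)^{\alpha-1}f(s)\,ds$ (Bochner integral). $N_{\alpha,p}$ denotes the operator norm of $J^\alpha_{t_0,t}$ from $L^p(t_0,t_1;X)$ into itself. Define $\eta,\theta:(1,\infty)\to(0,\infty)$ by $\eta(t)=\frac{t^{t-1}(t-1)}{t^t-(t-1)^{t-1}}$ and $\theta(t)=\frac{t^{1/(t-1)}}{t^{t/(t-1)}-(t-1)}$. The function $\eta$ is continuous and increasing with $\lim_{t\to1^+}\eta(t)=0$ and $\lim_{t\to\infty}\eta(t)=1$; the function $\theta$ is continuous and decreasing with $\lim_{t\to1^+}\theta(t)=1$ and $\lim_{t\to\infty}\theta(t)=0$. For $0<\alpha<1$, $p_{1,\alpha}$ and $p_{2,\alpha}$ are the unique solutions in $(1,\infty)$ of $\alpha=\eta(p_{1,\alpha})$ and $\alpha=\theta(p_{2,\alpha})$, respectively. (B) is the bound, stated in the paper for $\alpha>0$, $1<p<\infty$ and $X$ a reflexive Banach space: $N_{\alpha,p}<\frac{(t_1-t_0)^\alpha}{\Gamma(\alpha+1)}$. (E) is the following pair of estimates, for $\alpha>0$ and $1<p<\infty$: if $\alpha>1/p^*$, then $\|J^\alpha_{t_0,t}f\|_{L^p(t_0,t_1;X)}\le\frac{(t_1-t_0)^\alpha}{\Gamma(\alpha)[(\alpha-1)p+1]^{1/p}(\alpha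 p^* )^{1/p^*}}\|f\|_{L^p(t_0,t_1;X)}$ for every $f\in L^p(t_0,t_1;X)$; if $\alpha>1/p$, then $\|J^\alpha_{t_0,t}f\|_{L^p(t_0,t_1;X)}\le\frac{(t_1-t_0)^\alpha}{\Gamma(\alpha)[(\alpha-1)p^*+1]^{1/p^*}(\alpha p)^{1/p}}\|f\|_{L^p(t_0,t_1;X)}$ for every $f\in L^p(t_0,t_1;X)$. The two "otherwise" clauses are informal remarks in the paper's statement and are reproduced as such. *)

theory Defs
  imports "HOL-Analysis.Analysis"
begin

section \<open>Bochner integral in arbitrary Banach spaces\<close>

(* The library's has_bochner_integral and integrable are restricted to second countable
   (that is, separable) target spaces.  The definitions below drop that restriction:
   Borel measurability is replaced by strong measurability and the rest of the library
   definition is kept. *)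

definition strongly_measurable :: "'a measure \<Rightarrow> ('a \<Rightarrow> 'b::real_normed_vector) \<Rightarrow> bool" where
  "strongly_measurable M f \<longleftrightarrow>
     (\<exists>s. (\<forall>i. simple_function M (s i)) \<and> (AE x in M. (\<lambda>i. s i x) \<longlonglongrightarrow> f x))"

definition has_strong_bochner_integral ::
    "'a measure \<Rightarrow> ('a \<Rightarrow> 'b::real_normed_vector) \<Rightarrow> 'b \<Rightarrow> bool" where
  "has_strong_bochner_integral M f v \<longleftrightarrow>
     strongly_measurable M f \<and>
     (\<exists>s. (\<forall>i. Bochner_Integration.simple_bochner_integrable M (s i)) \<and>
          (\<lambda>i. \<integral>\<^sup>+x. ennreal (norm (f x - s i x)) \<partial>M) \<longlonglongrightarrow> 0 \<and>
          (\<lambda>i. Bochner_Integration.simple_bochner_integral M (s i)) \<longlonglongrightarrow> v)"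

definition strong_bochner_integral ::
    "'a measure \<Rightarrow> ('a \<Rightarrow> 'b::real_normed_vector) \<Rightarrow> 'b" where
  "strong_bochner_integral M f =
     (if \<exists>v. has_strong_bochner_integral M f v
      then THE v. has_strong_bochner_integral M f v else 0)"

lemma has_bochner_integral_imp_strong:
  assumes "has_bochner_integral M f v"
  shows "has_strong_bochner_integral M f v"
proof -
  have f: "f \<in> borel_measurable M"
    using assms by (rule borel_measurable_has_bochner_integral)
  obtain s where s: "\<And>i. simple_function M (s i)"
    "\<And>x. x \<in> space M \<Longrightarrow> (\<lambda>i. s i x) \<longlonglongrightarrow> f x"
    using borel_measurable_implies_sequence_metric[OF f, of 0] by metis
  have "strongly_measurable M f"
    unfolding strongly_measurable_def using s by (auto intro!: exI[of _ s] AE_I2)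
  with assms show ?thesis
    unfolding has_strong_bochner_integral_def by (auto elim!: has_bochner_integral.cases)
qed

lemma strongly_measurable_norm_diff_AE:
  assumes f: "strongly_measurable M f" and t: "simple_function M t"
  shows "\<exists>g \<in> borel_measurable M. AE x in M. ennreal (norm (f x - t x)) = g x"
proof -
  obtain s where s: "\<And>i. simple_function M (s i)" "AE x in M. (\<lambda>i. s i x) \<longlonglongrightarrow> f x"
    using f unfolding strongly_measurable_def by auto
  have m: "(\<lambda>x. norm (s i x - t x)) \<in> borel_measurable M" for i
    by (intro borel_measurable_simple_function
        simple_function_compose2[of M "s i" t "\<lambda>a b. norm (a - b)"] s t)
  have "AE x in M. ennreal (norm (f x - t x)) = ennreal (lim (\<lambda>i. norm (s i x - t x)))"
    using s(2)
  proof eventually_elim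
    case (elim x)
    then have "(\<lambda>i. norm (s i x - t x)) \<longlonglongrightarrow> norm (f x - t x)"
      by (intro tendsto_intros)
    then show ?case by (simp add: limI)
  qed
  moreover have "(\<lambda>x. ennreal (lim (\<lambda>i. norm (s i x - t x)))) \<in> borel_measurable M"
    using borel_measurable_lim_metric[OF m] by measurable
  ultimately show ?thesis by (rule bexI)
qed

lemma strongly_measurable_simple_bochner_integral_bounded:
  assumes f: "strongly_measurable M f"
    and s: "Bochner_Integration.simple_bochner_integrable M s" and t: "Bochner_Integration.simple_bochner_integrable M t"
  shows "ennreal (norm (Bochner_Integration.simple_bochner_integral M s - Bochner_Integration.simple_bochner_integral M t)) \<le>
    (\<integral>\<^sup>+ x. ennreal (norm (f x - s x)) \<partial>M) + (\<integral>\<^sup>+ x. ennreal (norm (f x - t x)) \<partial>M)"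
proof -
  let ?s = "Bochner_Integration.simple_bochner_integral M s" and ?t = "Bochner_Integration.simple_bochner_integral M t"
  have sf: "simple_function M s" "simple_function M t"
    using s t by (auto elim: Bochner_Integration.simple_bochner_integrable.cases)
  obtain g where g: "g \<in> borel_measurable M" "AE x in M. ennreal (norm (f x - s x)) = g x"
    using strongly_measurable_norm_diff_AE[OF f sf(1)] by blast
  obtain h where h: "h \<in> borel_measurable M" "AE x in M. ennreal (norm (f x - t x)) = h x"
    using strongly_measurable_norm_diff_AE[OF f sf(2)] by blast
  have "ennreal (norm (?s - ?t)) = norm (Bochner_Integration.simple_bochner_integral M (\<lambda>x. s x - t x))"
    using s t by (subst simple_bochner_integral_diff) auto
  also have "\<dots> \<le> Bochner_Integration.simple_bochner_integral M (\<lambda>x. norm (s x - t x))"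
    using simple_bochner_integrable_compose2[of "(-)" M "s" "t"] s t
    by (auto intro!: simple_bochner_integral_norm_bound)
  also have "\<dots> = (\<integral>\<^sup>+x. norm (s x - t x) \<partial>M)"
    using simple_bochner_integrable_compose2[of "\<lambda>x y. norm (x - y)" M "s" "t"] s t
    by (auto intro!: simple_bochner_integral_eq_nn_integral)
  also have "\<dots> \<le> (\<integral>\<^sup>+x. g x + h x \<partial>M)"
  proof (rule nn_integral_mono_AE)
    show "AE x in M. ennreal (norm (s x - t x)) \<le> g x + h x"
      using g(2) h(2)
    proof eventually_elim
      case (elim x)
      have "norm (s x - t x) \<le> norm (f x - s x) + norm (f x - t x)"
        by (metis dual_order.refl norm_diff_triangle_le norm_minus_commute)
      then have "ennreal (norm (s x - t x)) \<le> ennreal (norm (f x - s x)) + ennreal (norm (f x - t x))"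
        by (metis ennreal_leI ennreal_plus norm_ge_zero)
      with elim show ?case by simp
    qed
  qed
  also have "\<dots> = (\<integral>\<^sup>+x. g x \<partial>M) + (\<integral>\<^sup>+x. h x \<partial>M)"
    using g(1) h(1) by (rule nn_integral_add)
  also have "\<dots> = (\<integral>\<^sup>+ x. ennreal (norm (f x - s x)) \<partial>M) + (\<integral>\<^sup>+ x. ennreal (norm (f x - t x)) \<partial>M)"
    using nn_integral_cong_AE[OF g(2)] nn_integral_cong_AE[OF h(2)] by simp
  finally show ?thesis .
qed

lemma has_strong_bochner_integral_unique:
  assumes "has_strong_bochner_integral M f v" "has_strong_bochner_integral M f w"
  shows "v = w"
proof -
  have f: "strongly_measurable M f"
    using assms(1) by (simp add: has_strong_bochner_integral_def)
  obtain s where s: "\<And>i. Bochner_Integration.simple_bochner_integrable M (s i)"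
      "(\<lambda>i. \<integral>\<^sup>+x. ennreal (norm (f x - s i x)) \<partial>M) \<longlonglongrightarrow> 0"
      "(\<lambda>i. Bochner_Integration.simple_bochner_integral M (s i)) \<longlonglongrightarrow> v"
    using assms(1) unfolding has_strong_bochner_integral_def by auto
  obtain t where t: "\<And>i. Bochner_Integration.simple_bochner_integrable M (t i)"
      "(\<lambda>i. \<integral>\<^sup>+x. ennreal (norm (f x - t i x)) \<partial>M) \<longlonglongrightarrow> 0"
      "(\<lambda>i. Bochner_Integration.simple_bochner_integral M (t i)) \<longlonglongrightarrow> w"
    using assms(2) unfolding has_strong_bochner_integral_def by auto
  let ?d = "\<lambda>i. ennreal (norm (Bochner_Integration.simple_bochner_integral M (s i) - Bochner_Integration.simple_bochner_integral M (t i)))"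
  have "?d \<longlonglongrightarrow> ennreal (norm (v - w))"
    using s(3) t(3) by (intro tendsto_intros)
  moreover have "?d \<longlonglongrightarrow> 0"
  proof (rule tendsto_sandwich[where f = "\<lambda>_. 0"])
    show "eventually (\<lambda>i. ?d i \<le> (\<integral>\<^sup>+x. ennreal (norm (f x - s i x)) \<partial>M)
        + (\<integral>\<^sup>+x. ennreal (norm (f x - t i x)) \<partial>M)) sequentially"
      by (intro always_eventually allI strongly_measurable_simple_bochner_integral_bounded f s t)
    show "(\<lambda>i. (\<integral>\<^sup>+x. ennreal (norm (f x - s i x)) \<partial>M)
        + (\<integral>\<^sup>+x. ennreal (norm (f x - t i x)) \<partial>M)) \<longlonglongrightarrow> 0"
      using tendsto_add[OF s(2) t(2)] by simp
  qed auto
  ultimately have "ennreal (norm (v - w)) = 0"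
    by (rule LIMSEQ_unique)
  then show ?thesis by simp
qed

lemma strong_bochner_integral_eq:
  "has_strong_bochner_integral M f v \<Longrightarrow> strong_bochner_integral M f = v"
  unfolding strong_bochner_integral_def
  using has_strong_bochner_integral_unique by (metis the_equality)

section \<open>The spaces \<open>L\<^sup>p\<close> and the Riemann-Liouville integral\<close>

definition Lp_norm :: "'a measure \<Rightarrow> real \<Rightarrow> ('a \<Rightarrow> 'b::real_normed_vector) \<Rightarrow> ennreal" where
  "Lp_norm M p f =
     (let I = \<integral>\<^sup>+x. ennreal (norm (f x) powr p) \<partial>M
      in if I = \<infinity> then \<infinity> else ennreal (enn2real I powr (1 / p)))"

(* Functions rather than classes modulo almost everywhere equality; Lp_norm is then a seminorm. *)
definition Lp_space :: "'a measure \<Rightarrow> real \<Rightarrow> ('a \<Rightarrow> 'b::real_normed_vector) set" where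
  "Lp_space M p = {f. strongly_measurable M f \<and> Lp_norm M p f < \<infinity>}"

(* For 0 < \<alpha> < 1 and f in L^p the integral exists for almost every t only; on the exceptional
   null set the value 0 is used. *)
definition RL_integral :: "real \<Rightarrow> real \<Rightarrow> (real \<Rightarrow> 'x::banach) \<Rightarrow> real \<Rightarrow> 'x" where
  "RL_integral t0 \<alpha> f t =
     (1 / Gamma \<alpha>) *\<^sub>R
       strong_bochner_integral (lebesgue_on {t0..t}) (\<lambda>s. ((t - s) powr (\<alpha> - 1)) *\<^sub>R f s)"

(* The operator norm is taken in ennreal, so an upper bound for it includes boundedness
   of the operator. *)
definition RL_opnorm :: "'x::banach itself \<Rightarrow> real \<Rightarrow> real \<Rightarrow> real \<Rightarrow> real \<Rightarrow> ennreal" where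
  "RL_opnorm _ t0 t1 \<alpha> p =
     (SUP f \<in> {f :: real \<Rightarrow> 'x. f \<in> Lp_space (lebesgue_on {t0..t1}) p \<and>
                                Lp_norm (lebesgue_on {t0..t1}) p f \<le> 1}.
        Lp_norm (lebesgue_on {t0..t1}) p (RL_integral t0 \<alpha> f))"

section \<open>The threshold exponents\<close>

definition eta :: "real \<Rightarrow> real" where
  "eta t = t powr (t - 1) * (t - 1) / (t powr t - (t - 1) powr (t - 1))"

definition theta :: "real \<Rightarrow> real" where
  "theta t = t powr (1 / (t - 1)) / (t powr (t / (t - 1)) - (t - 1))"

(* On (1, \<infinity>), eta increases strictly from 0 to 1 and theta decreases strictly from 1 to 0, so for
   0 < \<alpha> < 1 the two solutions below exist and are unique. *)
definition p1 :: "real \<Rightarrow> real" where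
  "p1 \<alpha> = (THE p. 1 < p \<and> \<alpha> = eta p)"

definition p2 :: "real \<Rightarrow> real" where
  "p2 \<alpha> = (THE p. 1 < p \<and> \<alpha> = theta p)"

end

theory Submission
  imports Defs "HOL-Real_Asymp.Real_Asymp"
begin

text \<open>Both operator bounds are mixed norm estimates for the kernel \<open>k t s = (t - s)\<^bsup>\<alpha>-1\<^esup>\<close> on \<open>s < t\<close>, applied to
the scalar function \<open>g = norm f\<close>. If \<open>1 / p < \<alpha>\<close>, the kernel is \<open>q\<close>-integrable in \<open>s\<close>; Hoelder's
inequality in \<open>s\<close> followed by integration in \<open>t\<close> gives the constant of the second part
(\<open>RL_opnorm_le_fixed_time\<close>). If \<open>1 / q < \<alpha>\<close>, the kernel is \<open>p\<close>-integrable in \<open>t\<close>; Minkowski's integral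
inequality followed by Hoelder's inequality in \<open>s\<close> gives the constant of the first part
(\<open>RL_opnorm_le_fixed_source\<close>). The passage from \<open>f\<close> to \<open>g\<close> rests on \<open>norm_strong_bochner_integral_le\<close>
and \<open>strongly_measurable_imp_norm_borel\<close>.

The comparison with \<open>(t1 - t0)\<^bsup>\<alpha>\<^esup> / Gamma (\<alpha> + 1)\<close> is algebra: the first constant is the smaller one
exactly if \<open>eta p < \<alpha>\<close> (\<open>bound_less_iff_eta_less\<close>). As \<open>eta\<close> increases strictly from \<open>0\<close> to \<open>1\<close> on
\<open>(1, \<infinity>)\<close>, this means \<open>p < p1 \<alpha>\<close>. The analytic point is the monotonicity of \<open>eta\<close>
(\<open>recip_eta_strict_antimono\<close>). The second constant is the first one with \<open>p\<close> and \<open>q\<close> exchanged, and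
\<open>theta p = eta q\<close>, so its threshold \<open>p2 \<alpha>\<close> is the conjugate exponent of \<open>p1 \<alpha>\<close>.\<close>

section \<open>The threshold exponents\<close>

text \<open>The reciprocal of \<open>eta\<close> in the variable \<open>x = 1 - 1/t\<close>, which maps \<open>(1, \<infinity>)\<close> onto \<open>(0, 1)\<close>.
The exponential is \<open>h(x) = (1 - x) x\<^bsup>x/(1-x)\<^esup>\<close>; it is written through its
logarithm, whose derivative is the simple one.\<close>
definition recip_eta :: "real \<Rightarrow> real" where
  "recip_eta x = (1 - exp (ln (1 - x) + x * ln x / (1 - x))) / x"

text \<open>The logarithmic derivative of \<open>h\<close> collapses to \<open>ln x / (1 - x)\<^sup>2\<close>, so the derivative of
\<open>(1 - h(x)) / x\<close> has the sign of \<open>h (1 + u) - 1\<close> with \<open>u = - x ln x / (1 - x)\<^sup>2 > 0\<close>. Since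
\<open>h = (1 - x) exp (-(1 - x) u)\<close>, the inequality \<open>h (1 + u) < 1\<close> is a consequence of
\<open>(1 - x) (1 + u) < 1 + v \<le> exp v\<close> for \<open>v = (1 - x) u\<close>.\<close>
lemma recip_eta_strict_antimono:
  assumes "0 < x" "x < y" "y < 1"
  shows "recip_eta y < recip_eta x"
proof (rule DERIV_neg_imp_decreasing[OF assms(2)])
  fix z assume "x \<le> z" "z \<le> y"
  then have z: "0 < z" "z < 1" using assms by auto
  define h where "h = exp (ln (1 - z) + z * ln z / (1 - z))"
  define u where "u = - z * ln z / (1 - z)\<^sup>2"
  have "z * ln z < 0" using z by (simp add: mult_pos_neg)
  then have u: "0 < u" unfolding u_def using z by (simp add: divide_neg_pos)
  have D: "(recip_eta has_real_derivative
      ((- (h * (ln z / (1 - z)\<^sup>2))) * z - (1 - h)) / (z * z)) (at z)"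
    unfolding recip_eta_def
  proof (rule DERIV_divide[OF DERIV_diff[OF DERIV_const] DERIV_ident, THEN DERIV_cong])
    show "((\<lambda>x. exp (ln (1 - x) + x * ln x / (1 - x))) has_real_derivative
        h * (ln z / (1 - z)\<^sup>2)) (at z)"
    proof (rule DERIV_fun_exp[THEN DERIV_cong])
      show "((\<lambda>x. ln (1 - x) + x * ln x / (1 - x)) has_real_derivative
          - 1 / (1 - z) + ((ln z + 1) * (1 - z) + z * ln z) / (1 - z)\<^sup>2) (at z)"
        by (rule derivative_eq_intros refl | use z in \<open>simp add: power2_eq_square\<close>)+
      have "- 1 / (1 - z) + ((ln z + 1) * (1 - z) + z * ln z) / (1 - z)\<^sup>2 = ln z / (1 - z)\<^sup>2"
      proof -
        have "- 1 / (1 - z) + ((ln z + 1) * (1 - z) + z * ln z) / (1 - z)\<^sup>2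
            = (- (1 - z) + ((ln z + 1) * (1 - z) + z * ln z)) / (1 - z)\<^sup>2"
        proof -
          have "- 1 / (1 - z) = - (1 - z) / (1 - z)\<^sup>2"
          proof -
            have "- 1 / w = - w / w\<^sup>2" if "w \<noteq> 0" for w :: real
              using that by (simp add: power2_eq_square)
            from this[of "1 - z"] z show ?thesis by simp
          qed
          then show ?thesis by (simp only: add_divide_distrib)
        qed
        also have "- (1 - z) + ((ln z + 1) * (1 - z) + z * ln z) = ln z"
          by (simp add: algebra_simps)
        finally show ?thesis .
      qed
      then show "exp (ln (1 - z) + z * ln z / (1 - z)) *
          (- 1 / (1 - z) + ((ln z + 1) * (1 - z) + z * ln z) / (1 - z)\<^sup>2) = h * (ln z / (1 - z)\<^sup>2)"
        by (simp add: h_def)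
    qed
  qed (use z in \<open>auto simp: h_def\<close>)
  have "h = (1 - z) * exp (- ((1 - z) * u))"
    unfolding h_def u_def using z by (simp add: exp_add power2_eq_square)
  also have "\<dots> * (1 + u) < 1"
  proof -
    have "(1 - z) * (1 + u) < 1 + (1 - z) * u"
      using z by (simp add: algebra_simps)
    also have "\<dots> \<le> exp ((1 - z) * u)" by (rule exp_ge_add_one_self)
    finally have "(1 - z) * (1 + u) / exp ((1 - z) * u) < 1" by simp
    then show ?thesis by (simp only: exp_minus divide_inverse mult_ac)
  qed
  finally have "h * (1 + u) < 1" .
  moreover have "((- (h * (ln z / (1 - z)\<^sup>2))) * z - (1 - h)) = h * (1 + u) - 1"
    by (simp add: u_def algebra_simps)
  ultimately have "((- (h * (ln z / (1 - z)\<^sup>2))) * z - (1 - h)) / (z * z) < 0"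
    using z by (simp add: divide_neg_pos)
  with D show "\<exists>d. (recip_eta has_real_derivative d) (at z) \<and> d < 0" by blast
qed

lemma eta_denominator_pos:
  fixes t :: real
  assumes "1 < t"
  shows "(t - 1) powr (t - 1) < t powr t"
proof -
  have "(t - 1) powr (t - 1) < t powr (t - 1)"
    using assms by (intro powr_less_mono2) linarith+
  also have "\<dots> \<le> t powr t" using assms by (intro powr_mono) auto
  finally show ?thesis .
qed

lemma eta_pos: "1 < t \<Longrightarrow> 0 < eta t"
  using eta_denominator_pos[of t] unfolding eta_def by simp

lemma eta_eq_inverse_recip_eta:
  assumes "1 < t"
  shows "eta t = inverse (recip_eta (1 - 1 / t))"
proof -
  have e: "exp (ln (1 / t) + (t - 1) * (ln (t - 1) - ln t)) = (t - 1) powr (t - 1) / t powr t"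
    using assms by (simp add: powr_def ln_div exp_diff[symmetric] algebra_simps)
  have "recip_eta (1 - 1 / t) = (1 - exp (ln (1 / t) + (t - 1) * (ln (t - 1) - ln t))) / ((t - 1) / t)"
  proof -
    have "ln (1 - 1 / t) = ln (t - 1) - ln t"
      using assms ln_div[of "t - 1" t] by (simp add: diff_divide_distrib)
    moreover have "(1 - 1 / t) * a / (1 - (1 - 1 / t)) = (t - 1) * a" for a
      using assms by (simp add: left_diff_distrib right_diff_distrib)
    moreover have "1 - 1 / t = (t - 1) / t" using assms by (simp add: diff_divide_distrib)
    moreover have "1 - (1 - 1 / t) = 1 / t" by simp
    ultimately show ?thesis
      unfolding recip_eta_def by metis
  qed
  also have "\<dots> = (t powr t - (t - 1) powr (t - 1)) / (t powr (t - 1) * (t - 1))"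
    unfolding e using assms by (simp add: powr_diff divide_simps)
  finally show ?thesis by (simp add: eta_def)
qed

lemma eta_strict_mono:
  assumes "1 < s" "s < t"
  shows "eta s < eta t"
proof -
  have "recip_eta (1 - 1 / t) < recip_eta (1 - 1 / s)"
    using assms by (intro recip_eta_strict_antimono) (auto simp: field_simps)
  moreover have "0 < recip_eta (1 - 1 / t)"
    using eta_pos[of t] eta_eq_inverse_recip_eta[of t] assms by simp
  ultimately show ?thesis
    using assms by (simp add: eta_eq_inverse_recip_eta)
qed

lemma eta_less_iff: "1 < s \<Longrightarrow> 1 < t \<Longrightarrow> eta s < eta t \<longleftrightarrow> s < t"
  by (metis eta_strict_mono linorder_less_linear order_less_asym)

lemma eta_tendsto_0: "(eta \<longlongrightarrow> 0) (at_right 1)"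
  unfolding eta_def by real_asymp

lemma eta_tendsto_1: "(eta \<longlongrightarrow> 1) at_top"
  unfolding eta_def by real_asymp

lemma eta_surj:
  assumes "0 < \<alpha>" "\<alpha> < 1"
  shows "\<exists>p. 1 < p \<and> \<alpha> = eta p"
proof -
  have "eventually (\<lambda>t. eta t < \<alpha>) (at_right 1)"
    using eta_tendsto_0 assms(1) by (rule order_tendstoD)
  then obtain b where b: "1 < b" "\<And>t. 1 < t \<Longrightarrow> t < b \<Longrightarrow> eta t < \<alpha>"
    unfolding eventually_at_right_field by blast
  define s where "s = (1 + b) / 2"
  have s: "1 < s" "eta s < \<alpha>" using b unfolding s_def by auto
  have "eventually (\<lambda>t. \<alpha> < eta t \<and> s < t) at_top"
    using order_tendstoD(1)[OF eta_tendsto_1 assms(2)] eventually_gt_at_top[of s]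
    by eventually_elim simp
  then obtain t where t: "\<alpha> < eta t" "s < t"
    using eventually_happens by fastforce
  have "continuous_on {s..t} eta"
    unfolding eta_def
  proof (intro continuous_intros ballI)
    fix x assume "x \<in> {s..t}"
    then have "1 < x" using s by auto
    then show "x \<noteq> 0" "x - 1 \<noteq> 0" "x powr x - (x - 1) powr (x - 1) \<noteq> 0" "x \<noteq> 0"
      using eta_denominator_pos[of x] by auto
  qed
  then obtain p where "s \<le> p" "p \<le> t" "eta p = \<alpha>"
    using IVT'[of eta s \<alpha> t] s t by auto
  with s show ?thesis by (intro exI[of _ p]) auto
qed

text \<open>Conjugation of exponents exchanges the two threshold functions, and hence \<open>p1\<close> and \<open>p2\<close>: this
is what makes the second half of the theorem a reflection of the first one.\<close>
lemma theta_eq_eta_conjugate: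
  assumes "1 < p"
  shows "theta p = eta (p / (p - 1))"
proof -
  define q where "q = p / (p - 1)"
  have q: "q - 1 = 1 / (p - 1)" "q = 1 / (p - 1) + 1" using assms by (auto simp: q_def field_simps)
  have a: "q powr (q - 1) = p powr (q - 1) / (p - 1) powr (q - 1)"
    "q powr q = p powr q / (p - 1) powr q"
    using assms by (auto simp: q_def powr_divide)
  have b: "(1 / (p - 1)) powr (q - 1) = (p - 1) / (p - 1) powr q"
    using assms by (simp add: powr_divide powr_diff)
  have c: "(p - 1) powr (q - 1) = (p - 1) powr q / (p - 1)"
    using assms by (simp add: powr_diff)
  have "eta q = p powr (q - 1) / (p powr q - (p - 1))"
    unfolding eta_def a unfolding q(1) b[unfolded q(1)]
    using assms c[unfolded q(1)] by (simp add: divide_simps)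
  then show ?thesis unfolding theta_def q_def[symmetric] q(1) by (rule sym)
qed

lemma p1_characterization:
  assumes "0 < \<alpha>" "\<alpha> < 1"
  shows "1 < p1 \<alpha>" "eta (p1 \<alpha>) = \<alpha>"
proof -
  have "\<exists>!p. 1 < p \<and> \<alpha> = eta p"
    using eta_surj[OF assms] eta_strict_mono by (metis linorder_less_linear order_less_irrefl)
  from theI'[OF this] show "1 < p1 \<alpha>" "eta (p1 \<alpha>) = \<alpha>"
    unfolding p1_def by auto
qed

lemma less_p1_iff:
  assumes "0 < \<alpha>" "\<alpha> < 1" "1 < p"
  shows "p < p1 \<alpha> \<longleftrightarrow> eta p < \<alpha>"
  using eta_less_iff[OF assms(3) p1_characterization(1)[OF assms(1,2)]]
    p1_characterization(2)[OF assms(1,2)] by simp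

lemma conjugate_exponent:
  fixes p :: real
  assumes "1 < p"
  shows "1 < p / (p - 1)" "p / (p - 1) / (p / (p - 1) - 1) = p"
  using assms by (auto simp: field_simps)

lemma p2_eq_conjugate_p1:
  assumes "0 < \<alpha>" "\<alpha> < 1"
  shows "p2 \<alpha> = p1 \<alpha> / (p1 \<alpha> - 1)"
  unfolding p2_def
proof (rule the_equality)
  note P = p1_characterization[OF assms]
  show "1 < p1 \<alpha> / (p1 \<alpha> - 1) \<and> \<alpha> = theta (p1 \<alpha> / (p1 \<alpha> - 1))"
    using conjugate_exponent[OF P(1)] P by (simp add: theta_eq_eta_conjugate)
  fix p assume p: "1 < p \<and> \<alpha> = theta p"
  then have "eta (p / (p - 1)) = eta (p1 \<alpha>)"
    using P by (simp add: theta_eq_eta_conjugate)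
  then have "p / (p - 1) = p1 \<alpha>"
    using eta_strict_mono P conjugate_exponent p by (metis linorder_less_linear order_less_irrefl)
  then show "p = p1 \<alpha> / (p1 \<alpha> - 1)"
    using conjugate_exponent(2)[of p] p by simp
qed

lemma p2_less_iff:
  assumes "0 < \<alpha>" "\<alpha> < 1" "1 < p"
  shows "p2 \<alpha> < p \<longleftrightarrow> p / (p - 1) < p1 \<alpha>"
proof -
  have "1 < p1 \<alpha>" using p1_characterization assms by blast
  with assms(3) show ?thesis
    unfolding p2_eq_conjugate_p1[OF assms(1,2)] by (simp add: field_simps)
qed

text \<open>After \<open>Gamma (\<alpha> + 1) = \<alpha> Gamma \<alpha>\<close> and cancellation the left inequality says
\<open>\<alpha> < ((\<alpha> - 1) p + 1)\<^bsup>1/p\<^esup> (\<alpha> q)\<^bsup>1/q\<^esup>\<close>. After raising to the power \<open>p\<close> both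
sides contain the factor \<open>\<alpha>\<^bsup>p-1\<^esup>\<close>; without it the inequality is linear in \<open>\<alpha>\<close>, and solving for \<open>\<alpha>\<close> gives \<open>eta p\<close>.\<close>
lemma bound_less_iff_eta_less:
  fixes p q \<alpha> T :: real
  assumes "0 < T" "0 < \<alpha>" "1 < p" "q = p / (p - 1)" "1 / q < \<alpha>"
  shows "T powr \<alpha> / (Gamma \<alpha> * ((\<alpha> - 1) * p + 1) powr (1 / p) * (\<alpha> * q) powr (1 / q))
           < T powr \<alpha> / Gamma (\<alpha> + 1) \<longleftrightarrow> eta p < \<alpha>" (is "?l \<longleftrightarrow> _")
proof -
  define c where "c = (\<alpha> - 1) * p + 1"
  define A where "A = c powr (1 / p) * (\<alpha> * q) powr (1 / q)"
  have q: "1 < q" "1 / q = (p - 1) / p" using assms(3) unfolding assms(4) by (auto simp: field_simps)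
  have c: "0 < c" using assms q unfolding c_def by (simp add: field_simps)
  have A: "0 < A" unfolding A_def using c assms q by simp
  have G: "Gamma (\<alpha> + 1) = \<alpha> * Gamma \<alpha>" using assms by (intro Gamma_plus1) (auto dest: nonpos_Ints_nonpos)
  have Gp: "0 < Gamma \<alpha>" using assms by (simp add: Gamma_real_pos)
  define P where "P = p powr (p - 1)"
  define R where "R = (p - 1) powr (p - 1)"
  have PR: "0 < P" "0 < R" using assms unfolding P_def R_def by auto
  have pp: "p powr p = p * P" using assms by (simp add: P_def powr_diff)
  have "?l \<longleftrightarrow> T powr \<alpha> / (Gamma \<alpha> * A) < T powr \<alpha> / (Gamma \<alpha> * \<alpha>)"
    by (simp add: A_def c_def G mult.assoc mult.commute[of \<alpha>])
  also have "\<dots> \<longleftrightarrow> \<alpha> < A"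
  proof -
    have "X / (G * a) < X / (G * b) \<longleftrightarrow> b < a" if "0 < X" "0 < G" "0 < a" "0 < b" for X G a b :: real
      using that by (auto simp: field_simps)
    then show ?thesis using assms(1,2) Gp A by simp
  qed
  also have "\<dots> \<longleftrightarrow> \<alpha> powr p < A powr p"
    using assms A by (metis less_eq_real_def not_less powr_less_mono2 order_less_trans zero_less_one order.strict_implies_order)
  also have "A powr p = c * (\<alpha> * q) powr (p - 1)"
    unfolding A_def using c assms q by (simp add: powr_mult powr_powr)
  also have "\<dots> = \<alpha> powr p * (c * P / (R * \<alpha>))"
  proof -
    have "(\<alpha> * q) powr (p - 1) = \<alpha> powr (p - 1) * (P / R)"
      using assms by (simp add: powr_mult powr_divide P_def R_def)
    moreover have "\<alpha> powr (p - 1) = \<alpha> powr p / \<alpha>" using assms(2) by (simp add: powr_diff)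
    ultimately show ?thesis by (simp add: mult_ac)
  qed
  also have "\<alpha> powr p < \<alpha> powr p * (c * P / (R * \<alpha>)) \<longleftrightarrow> R * \<alpha> < c * P"
    using assms PR by (simp add: field_simps)
  also have "\<dots> \<longleftrightarrow> eta p < \<alpha>"
    unfolding eta_def P_def[symmetric] R_def[symmetric] c_def using eta_denominator_pos[of p] assms pp
    by (simp add: R_def[symmetric] divide_less_eq algebra_simps)
  finally show ?thesis .
qed

section \<open>Integral inequalities\<close>

text \<open>When \<open>f\<close> has no integral the left side is \<open>0\<close>, the default value. Otherwise one
compares the approximating simple integrals with the integral of the zero function and passes to the
limit. Holding for every \<open>f\<close>, the bound also covers the exceptional times at which a
Riemann-Liouville integral does not exist.\<close>
lemma norm_strong_bochner_integral_le:
  fixes f :: "'a \<Rightarrow> 'b::real_normed_vector"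
  shows "ennreal (norm (strong_bochner_integral M f)) \<le> (\<integral>\<^sup>+x. ennreal (norm (f x)) \<partial>M)"
proof (cases "\<exists>v. has_strong_bochner_integral M f v")
  case True
  then obtain v where v: "has_strong_bochner_integral M f v" by blast
  then obtain s where f: "strongly_measurable M f"
    and s: "\<And>i. Bochner_Integration.simple_bochner_integrable M (s i)"
      "(\<lambda>i. \<integral>\<^sup>+x. ennreal (norm (f x - s i x)) \<partial>M) \<longlonglongrightarrow> 0"
      "(\<lambda>i. Bochner_Integration.simple_bochner_integral M (s i)) \<longlonglongrightarrow> v"
    unfolding has_strong_bochner_integral_def by auto
  let ?I = "\<integral>\<^sup>+x. ennreal (norm (f x)) \<partial>M"
  have z: "Bochner_Integration.simple_bochner_integrable M (\<lambda>x. 0 :: 'b)"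
    by (auto intro!: Bochner_Integration.simple_bochner_integrable.intros)
  have lim_s: "(\<lambda>i. ennreal (norm (Bochner_Integration.simple_bochner_integral M (s i)))) \<longlonglongrightarrow> ennreal (norm v)"
    using s(3) by (intro tendsto_intros)
  have lim_bound: "(\<lambda>i. (\<integral>\<^sup>+x. ennreal (norm (f x - s i x)) \<partial>M) + ?I) \<longlonglongrightarrow> 0 + ?I"
    using s(2) by (intro tendsto_intros)
  have "ennreal (norm (Bochner_Integration.simple_bochner_integral M (s i)))
      \<le> (\<integral>\<^sup>+x. ennreal (norm (f x - s i x)) \<partial>M) + ?I" for i
  proof -
    have "Bochner_Integration.simple_bochner_integral M (\<lambda>x. 0 :: 'b) = 0"
      unfolding Bochner_Integration.simple_bochner_integral_def by (intro sum.neutral) auto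
    then show ?thesis
      using strongly_measurable_simple_bochner_integral_bounded[OF f s(1) z, of i] by simp
  qed
  then have "ennreal (norm v) \<le> 0 + ?I"
    by (intro LIMSEQ_le[OF lim_s lim_bound]) blast
  then show ?thesis using strong_bochner_integral_eq[OF v] by simp
qed (simp add: strong_bochner_integral_def)

text \<open>Young's inequality, applied to the normalised factors and integrated. The normalisation divides by
powers of \<open>A\<close> and \<open>B\<close>, so the case where one of them vanishes is separate: then the
corresponding factor is zero almost everywhere.\<close>
lemma nn_integral_Holder:
  fixes u v :: "'a \<Rightarrow> real"
  assumes [measurable]: "u \<in> borel_measurable M" "v \<in> borel_measurable M"
    and nonneg: "\<And>x. 0 \<le> u x" "\<And>x. 0 \<le> v x"
    and pq: "1 < p" "1 < q" "1 / p + 1 / q = 1"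
    and A: "0 \<le> A" "(\<integral>\<^sup>+x. ennreal (u x powr p) \<partial>M) \<le> ennreal A"
    and B: "0 \<le> B" "(\<integral>\<^sup>+x. ennreal (v x powr q) \<partial>M) \<le> ennreal B"
  shows "(\<integral>\<^sup>+x. ennreal (u x * v x) \<partial>M) \<le> ennreal (A powr (1 / p) * B powr (1 / q))"
proof (cases "A = 0 \<or> B = 0")
  case True
  have "AE x in M. w x = 0" if [measurable]: "w \<in> borel_measurable M"
    and "(\<integral>\<^sup>+x. ennreal (w x powr r) \<partial>M) \<le> ennreal 0" and "\<And>x. 0 \<le> w x" for w :: "'a \<Rightarrow> real" and r
  proof -
    have "(\<integral>\<^sup>+x. ennreal (w x powr r) \<partial>M) = 0" using that by simp
    then have "AE x in M. ennreal (w x powr r) = 0" by (subst (asm) nn_integral_0_iff_AE) auto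
    then show ?thesis by eventually_elim (simp add: ennreal_eq_0_iff powr_nonneg_iff)
  qed
  with True A B nonneg have "AE x in M. u x = 0 \<or> v x = 0"
    by (metis (mono_tags, lifting) assms(1,2) eventually_mono)
  then have "AE x in M. ennreal (u x * v x) = 0" by eventually_elim auto
  then have "(\<integral>\<^sup>+x. ennreal (u x * v x) \<partial>M) = 0"
    by (subst nn_integral_0_iff_AE) auto
  then show ?thesis by simp
next
  case False
  then have pos: "0 < A" "0 < B" using A B by auto
  define a where "a = A powr (1 / p)"
  define b where "b = B powr (1 / q)"
  have ab: "0 < a" "0 < b" "a powr p = A" "b powr q = B"
    using pos pq by (auto simp: a_def b_def powr_powr)
  have pt: "u x * v x \<le> a * b / (p * A) * u x powr p + a * b / (q * B) * v x powr q" for x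
  proof -
    have "(u x / a) * (v x / b) \<le> (u x / a) powr p / p + (v x / b) powr q / q"
      using Youngs_inequality[of p q "u x / a" "v x / b"] pq nonneg ab by simp
    also have "\<dots> = u x powr p / (p * A) + v x powr q / (q * B)"
      using nonneg ab by (simp add: powr_divide mult.commute)
    finally have "a * b * ((u x / a) * (v x / b)) \<le> a * b * (u x powr p / (p * A) + v x powr q / (q * B))"
      using ab by (intro mult_left_mono) auto
    then show ?thesis using ab by (simp add: distrib_left)
  qed
  have "(\<integral>\<^sup>+x. ennreal (u x * v x) \<partial>M)
      \<le> (\<integral>\<^sup>+x. ennreal (a * b / (p * A)) * ennreal (u x powr p) + ennreal (a * b / (q * B)) * ennreal (v x powr q) \<partial>M)"
    using pt ab pq pos nonneg
    by (intro nn_integral_mono) (simp add: ennreal_mult[symmetric] ennreal_plus[symmetric] ennreal_leI del: ennreal_plus)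
  also have "\<dots> = ennreal (a * b / (p * A)) * (\<integral>\<^sup>+x. ennreal (u x powr p) \<partial>M)
      + ennreal (a * b / (q * B)) * (\<integral>\<^sup>+x. ennreal (v x powr q) \<partial>M)"
    by (simp add: nn_integral_add nn_integral_cmult)
  also have "\<dots> \<le> ennreal (a * b / (p * A)) * ennreal A + ennreal (a * b / (q * B)) * ennreal B"
    using A B by (intro add_mono mult_left_mono) auto
  also have "\<dots> = ennreal (a * b / p + a * b / q)"
    using ab pq pos by (simp add: ennreal_mult[symmetric] ennreal_plus[symmetric] del: ennreal_plus)
  also have "a * b / p + a * b / q = a * b * (1 / p + 1 / q)" by (simp add: field_simps)
  also have "\<dots> = a * b" using pq by simp
  finally show ?thesis by (simp add: a_def b_def)
qed

lemma nn_integral_powr_from_left_end: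
  fixes a b r :: real
  assumes "a \<le> b" "-1 < r"
  shows "(\<integral>\<^sup>+t. ennreal ((t - a) powr r) * indicator {a..b} t \<partial>lborel) = ennreal ((b - a) powr (r + 1) / (r + 1))"
proof -
  have "(\<integral>\<^sup>+t. ennreal ((t - a) powr r) * indicator {a..b} t \<partial>lborel)
      = (\<integral>\<^sup>+t. ennreal (t powr r) * indicator {0..b - a} t \<partial>lborel)"
    by (subst nn_integral_real_affine[where c = 1 and t = a])
       (auto intro!: nn_integral_cong split: split_indicator)
  also have "\<dots> = ennreal ((b - a) powr (r + 1) / (r + 1))"
    using assms by (intro nn_integral_has_integral_lebesgue' has_integral_powr_from_0) auto
  finally show ?thesis .
qed

lemma nn_integral_powr_to_right_end:
  fixes a b r :: real
  assumes "a \<le> b" "-1 < r"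
  shows "(\<integral>\<^sup>+t. ennreal ((b - t) powr r) * indicator {a..b} t \<partial>lborel) = ennreal ((b - a) powr (r + 1) / (r + 1))"
proof -
  have "(\<integral>\<^sup>+t. ennreal ((b - t) powr r) * indicator {a..b} t \<partial>lborel)
      = (\<integral>\<^sup>+t. ennreal (t powr r) * indicator {0..b - a} t \<partial>lborel)"
    by (subst nn_integral_real_affine[where c = "-1" and t = b])
       (auto intro!: nn_integral_cong split: split_indicator)
  also have "\<dots> = ennreal ((b - a) powr (r + 1) / (r + 1))"
    using assms by (intro nn_integral_has_integral_lebesgue' has_integral_powr_from_0) auto
  finally show ?thesis .
qed

section \<open>Reduction to a scalar kernel\<close>

text \<open>The values of \<open>f\<close> need not lie in a second countable space, but its norm is, up to a null set, an
ordinary Borel function. From here on only this scalar function is integrated, with respect to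
\<open>lborel\<close>, where Tonelli's theorem applies.\<close>
lemma strongly_measurable_imp_norm_borel:
  fixes f :: "real \<Rightarrow> 'b::real_normed_vector"
  assumes "strongly_measurable (lebesgue_on S) f" and S[measurable]: "S \<in> sets borel"
  obtains g :: "real \<Rightarrow> real" where "g \<in> borel_measurable borel" "\<And>x. 0 \<le> g x" "\<And>x. x \<notin> S \<Longrightarrow> g x = 0"
    "AE x in lborel. x \<in> S \<longrightarrow> norm (f x) = g x"
proof -
  obtain h where h: "h \<in> borel_measurable (lebesgue_on S)"
    "AE x in lebesgue_on S. ennreal (norm (f x)) = h x"
    using strongly_measurable_norm_diff_AE[OF assms(1), of "\<lambda>_. 0"] by auto
  have S': "S \<in> sets lebesgue" using S by auto
  have "(\<lambda>x. enn2real (h x)) \<in> borel_measurable (lebesgue_on S)" using h(1) by measurable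
  then have "(\<lambda>x. if x \<in> S then enn2real (h x) else 0) \<in> borel_measurable lebesgue"
    by (rule borel_measurable_if_I[OF _ S'])
  from completion_ex_borel_measurable_real[OF this] obtain g where g: "g \<in> borel_measurable lborel"
    "AE x in lborel. (if x \<in> S then enn2real (h x) else 0) = g x"
    by auto
  have hN: "AE x in lborel. x \<in> S \<longrightarrow> ennreal (norm (f x)) = h x"
    using h(2) S' by (simp add: AE_restrict_space_iff AE_completion_iff)
  let ?g = "\<lambda>x. \<bar>g x\<bar> * indicator S x"
  show ?thesis
  proof (rule that[of ?g])
    show "?g \<in> borel_measurable borel" using g(1) by simp
    show "AE x in lborel. x \<in> S \<longrightarrow> norm (f x) = ?g x"
      using hN g(2)
    proof eventually_elim
      case (elim x)
      show ?case
      proof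
        assume "x \<in> S"
        with elim have "g x = enn2real (ennreal (norm (f x)))" by simp
        then show "norm (f x) = ?g x" using \<open>x \<in> S\<close> by simp
      qed
    qed
  qed auto
qed

text \<open>The function \<open>\<phi>\<close> is the \<open>p\<close>-th power in the definition of the \<open>L\<^sup>p\<close> norm, or multiplication by the
kernel; the latter is why it depends on the point as well.\<close>
lemma nn_integral_norm_lebesgue_on:
  fixes f :: "real \<Rightarrow> 'b::real_normed_vector"
  assumes S: "S \<in> sets borel"
    and "AE x in lborel. x \<in> S \<longrightarrow> norm (f x) = g x"
  shows "(\<integral>\<^sup>+x. ennreal (\<phi> x (norm (f x))) \<partial>lebesgue_on S)
           = (\<integral>\<^sup>+x. ennreal (\<phi> x (g x)) * indicator S x \<partial>lborel)"
proof -
  have S': "S \<inter> space lebesgue \<in> sets lebesgue" using S by auto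
  have "(\<integral>\<^sup>+x. ennreal (\<phi> x (norm (f x))) * indicator S x \<partial>lborel)
      = (\<integral>\<^sup>+x. ennreal (\<phi> x (g x)) * indicator S x \<partial>lborel)"
    using assms(2) by (intro nn_integral_cong_AE) (auto elim!: eventually_mono split: split_indicator)
  then show ?thesis
    by (simp add: nn_integral_restrict_space[OF S'] nn_integral_completion)
qed

lemma Lp_norm_le_iff:
  assumes "0 < p" "0 \<le> C"
  shows "Lp_norm M p f \<le> ennreal C \<longleftrightarrow> (\<integral>\<^sup>+x. ennreal (norm (f x) powr p) \<partial>M) \<le> ennreal (C powr p)"
proof (cases "\<integral>\<^sup>+x. ennreal (norm (f x) powr p) \<partial>M")
  case (real r)
  have "r powr (1 / p) \<le> C \<longleftrightarrow> r \<le> C powr p"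
    using powr_mono2[of p "r powr (1 / p)" C] powr_mono2[of "1 / p" r "C powr p"] assms real
    by (auto simp: powr_powr)
  then show ?thesis using real assms unfolding Lp_norm_def by simp
next
  case top
  then show ?thesis unfolding Lp_norm_def by (simp add: infinity_ennreal_def top_unique)
qed

text \<open>The singular kernel extended by zero to \<open>s > t\<close>, so that all integrals run over the whole line. On
the diagonal its value is \<open>0 powr (\<alpha> - 1) = 0\<close>.\<close>
definition RL_kernel :: "real \<Rightarrow> real \<Rightarrow> real \<Rightarrow> real" where
  "RL_kernel \<alpha> t s = (if s \<le> t then (t - s) powr (\<alpha> - 1) else 0)"

lemma RL_kernel_nonneg: "0 \<le> RL_kernel \<alpha> t s"
  by (simp add: RL_kernel_def)

lemma borel_measurable_RL_kernel [measurable]: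
  assumes [measurable]: "u \<in> borel_measurable M" "v \<in> borel_measurable M"
  shows "(\<lambda>x. RL_kernel \<alpha> (u x) (v x)) \<in> borel_measurable M"
  unfolding RL_kernel_def by measurable

lemma RL_kernel_powr:
  assumes "0 < r"
  shows "RL_kernel \<alpha> t s powr r = (if s \<le> t then (t - s) powr ((\<alpha> - 1) * r) else 0)"
  using assms by (simp add: RL_kernel_def powr_powr)

lemma norm_RL_integral_le:
  fixes f :: "real \<Rightarrow> 'x::banach"
  assumes "0 < \<alpha>" "a \<le> t" "t \<le> b" "AE x in lborel. x \<in> {a..b} \<longrightarrow> norm (f x) = g x"
    and g: "\<And>x. 0 \<le> g x" "\<And>x. x \<notin> {a..b} \<Longrightarrow> g x = 0"
  shows "ennreal (Gamma \<alpha> * norm (RL_integral a \<alpha> f t)) \<le> (\<integral>\<^sup>+s. ennreal (RL_kernel \<alpha> t s * g s) \<partial>lborel)"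
proof -
  have "Gamma \<alpha> * norm (RL_integral a \<alpha> f t)
      = norm (strong_bochner_integral (lebesgue_on {a..t}) (\<lambda>s. ((t - s) powr (\<alpha> - 1)) *\<^sub>R f s))"
    using Gamma_real_pos[OF assms(1)] by (simp add: RL_integral_def)
  then have "ennreal (Gamma \<alpha> * norm (RL_integral a \<alpha> f t))
      \<le> (\<integral>\<^sup>+s. ennreal ((t - s) powr (\<alpha> - 1) * norm (f s)) \<partial>lebesgue_on {a..t})"
    using norm_strong_bochner_integral_le[of "lebesgue_on {a..t}" "\<lambda>s. ((t - s) powr (\<alpha> - 1)) *\<^sub>R f s"]
    by simp
  also have "\<dots> = (\<integral>\<^sup>+s. ennreal ((t - s) powr (\<alpha> - 1) * g s) * indicator {a..t} s \<partial>lborel)"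
    using assms(3,4)
    by (intro nn_integral_norm_lebesgue_on[of "{a..t}" f g "\<lambda>s y. (t - s) powr (\<alpha> - 1) * y"])
       (auto elim!: eventually_mono)
  also have "\<dots> \<le> (\<integral>\<^sup>+s. ennreal (RL_kernel \<alpha> t s * g s) \<partial>lborel)"
    by (intro nn_integral_mono) (auto simp: RL_kernel_def split: split_indicator)
  finally show ?thesis .
qed

text \<open>Reduction to a scalar problem. A majorant \<open>H\<close> of the \<open>p\<close>-th power of the scalar integral
\<open>\<integral> RL_kernel \<alpha> t s * g s ds\<close> is required. That integral is extended real and may be infinite, where
no power is available; hence the majorant is asked to dominate \<open>y powr p\<close> for every finite \<open>y\<close> below
the integral.\<close>
lemma RL_opnorm_leI:
  fixes a b \<alpha> p C :: real
  assumes "0 < \<alpha>" "1 < p" "0 \<le> C"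
    and H: "\<And>g. g \<in> borel_measurable borel \<Longrightarrow> (\<And>x. 0 \<le> g x) \<Longrightarrow> (\<And>x. x \<notin> {a..b} \<Longrightarrow> g x = 0) \<Longrightarrow>
      (\<integral>\<^sup>+x. ennreal (g x powr p) \<partial>lborel) \<le> 1 \<Longrightarrow>
      \<exists>H \<in> borel_measurable borel. (\<integral>\<^sup>+t. H t * indicator {a..b} t \<partial>lborel) \<le> ennreal (C powr p) \<and>
        (\<forall>t\<in>{a..b}. \<forall>y\<ge>0. ennreal y \<le> (\<integral>\<^sup>+s. ennreal (RL_kernel \<alpha> t s * g s) \<partial>lborel) \<longrightarrow> ennreal (y powr p) \<le> H t)"
  shows "RL_opnorm TYPE('x::banach) a b \<alpha> p \<le> ennreal (C / Gamma \<alpha>)"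
  unfolding RL_opnorm_def
proof (rule SUP_least, clarify)
  fix f :: "real \<Rightarrow> 'x"
  assume f: "f \<in> Lp_space (lebesgue_on {a..b}) p" "Lp_norm (lebesgue_on {a..b}) p f \<le> 1"
  have G: "0 < Gamma \<alpha>" using assms(1) by (simp add: Gamma_real_pos)
  obtain g where g: "g \<in> borel_measurable borel" "\<And>x. 0 \<le> g x" "\<And>x. x \<notin> {a..b} \<Longrightarrow> g x = 0"
      "AE x in lborel. x \<in> {a..b} \<longrightarrow> norm (f x) = g x"
    using f(1) strongly_measurable_imp_norm_borel[of "{a..b}" f] unfolding Lp_space_def by auto
  have "(\<integral>\<^sup>+x. ennreal (g x powr p) \<partial>lborel) = (\<integral>\<^sup>+x. ennreal (g x powr p) * indicator {a..b} x \<partial>lborel)"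
    using g(3) by (intro nn_integral_cong) (auto split: split_indicator)
  also have "\<dots> = (\<integral>\<^sup>+x. ennreal (norm (f x) powr p) \<partial>lebesgue_on {a..b})"
    using nn_integral_norm_lebesgue_on[OF _ g(4), of "\<lambda>x y. y powr p"] by simp
  also have "\<dots> \<le> 1"
    using f(2) Lp_norm_le_iff[of p 1 "lebesgue_on {a..b}" f] assms(2) by simp
  finally have "(\<integral>\<^sup>+x. ennreal (g x powr p) \<partial>lborel) \<le> 1" .
  from H[OF g(1-3) this] obtain H where Hm[measurable]: "H \<in> borel_measurable borel"
    and H: "(\<integral>\<^sup>+t. H t * indicator {a..b} t \<partial>lborel) \<le> ennreal (C powr p)"
    "\<And>t y. t \<in> {a..b} \<Longrightarrow> 0 \<le> y \<Longrightarrow> ennreal y \<le> (\<integral>\<^sup>+s. ennreal (RL_kernel \<alpha> t s * g s) \<partial>lborel) \<Longrightarrow> ennreal (y powr p) \<le> H t"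
    by blast
  let ?c = "Gamma \<alpha> powr - p"
  have pt: "ennreal (norm (RL_integral a \<alpha> f t) powr p) \<le> ennreal ?c * H t" if t: "t \<in> {a..b}" for t
  proof -
    have "norm (RL_integral a \<alpha> f t) powr p = ?c * (Gamma \<alpha> * norm (RL_integral a \<alpha> f t)) powr p"
      using G by (simp add: powr_mult powr_minus)
    moreover have "ennreal ((Gamma \<alpha> * norm (RL_integral a \<alpha> f t)) powr p) \<le> H t"
      using t G by (intro H(2) norm_RL_integral_le[OF _ _ _ g(4)] assms(1) g(2,3)) auto
    ultimately show ?thesis by (simp add: ennreal_mult mult_left_mono)
  qed
  have "(\<integral>\<^sup>+t. ennreal (norm (RL_integral a \<alpha> f t) powr p) \<partial>lebesgue_on {a..b})
      = (\<integral>\<^sup>+t. ennreal (norm (RL_integral a \<alpha> f t) powr p) * indicator {a..b} t \<partial>lborel)"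
    using nn_integral_norm_lebesgue_on[of "{a..b}" "RL_integral a \<alpha> f" "\<lambda>t. norm (RL_integral a \<alpha> f t)" "\<lambda>t y. y powr p"]
    by simp
  also have "\<dots> \<le> (\<integral>\<^sup>+t. ennreal ?c * (H t * indicator {a..b} t) \<partial>lborel)"
    using pt by (intro nn_integral_mono) (auto split: split_indicator)
  also have "\<dots> = ennreal ?c * (\<integral>\<^sup>+t. H t * indicator {a..b} t \<partial>lborel)"
    by (simp add: nn_integral_cmult)
  also have "\<dots> \<le> ennreal ?c * ennreal (C powr p)"
    by (intro mult_left_mono H) auto
  also have "\<dots> = ennreal ((C / Gamma \<alpha>) powr p)"
    using G assms(2,3) by (simp add: ennreal_mult[symmetric] powr_divide powr_minus_divide)
  finally have "(\<integral>\<^sup>+t. ennreal (norm (RL_integral a \<alpha> f t) powr p) \<partial>lebesgue_on {a..b})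
      \<le> ennreal ((C / Gamma \<alpha>) powr p)" .
  moreover have "0 < p" "0 \<le> C / Gamma \<alpha>" using assms(2,3) G by auto
  ultimately show "Lp_norm (lebesgue_on {a..b}) p (RL_integral a \<alpha> f) \<le> ennreal (C / Gamma \<alpha>)"
    by (rule Lp_norm_le_iff[THEN iffD2, rotated 2])
qed

section \<open>Mixed norm estimates\<close>

text \<open>For fixed \<open>t\<close>, Hoelder's inequality bounds the integral by the \<open>L\<^sup>q\<close> norm of
the kernel in \<open>s\<close>, a power of \<open>t - a\<close>; the condition \<open>1 / p < \<alpha>\<close> says that the kernel is in \<open>L\<^sup>q\<close>. What
remains is the \<open>L\<^sup>p\<close> norm of that power.\<close>
lemma RL_opnorm_le_fixed_time:
  fixes a b \<alpha> p q :: real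
  assumes ab: "a < b" and "0 < \<alpha>" "1 < p" and q: "q = p / (p - 1)" and "1 / p < \<alpha>"
  shows "RL_opnorm TYPE('x::banach) a b \<alpha> p \<le>
    ennreal ((b - a) powr \<alpha> / (((\<alpha> - 1) * q + 1) powr (1 / q) * (\<alpha> * p) powr (1 / p)) / Gamma \<alpha>)"
proof (rule RL_opnorm_leI)
  define c where "c = (\<alpha> - 1) * q + 1"
  have q1: "1 < q" "1 / p + 1 / q = 1" using assms(3) unfolding q by (auto simp: field_simps)
  then have pq: "1 / p = 1 - 1 / q" by simp
  have c: "0 < c" using assms(5) q1 unfolding c_def pq by (simp add: field_simps)
  have e: "c * (p / q) = \<alpha> * p - 1"
  proof -
    have "p / q = p - 1" using assms(3) unfolding q by simp
    then have "c * (p / q) = (\<alpha> - 1) * (q * (p - 1)) + (p - 1)"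
      by (simp add: c_def distrib_right)
    also have "q * (p - 1) = p" using assms(3) unfolding q by simp
    finally show ?thesis by (simp add: left_diff_distrib)
  qed
  let ?C = "(b - a) powr \<alpha> / (c powr (1 / q) * (\<alpha> * p) powr (1 / p))"
  show "0 \<le> ?C" by simp
  fix g :: "real \<Rightarrow> real"
  assume g: "g \<in> borel_measurable borel" "\<And>x. 0 \<le> g x" "\<And>x. x \<notin> {a..b} \<Longrightarrow> g x = 0"
    "(\<integral>\<^sup>+x. ennreal (g x powr p) \<partial>lborel) \<le> 1"
  note [measurable] = g(1)
  let ?m = "\<lambda>t. (t - a) powr (c * (p / q)) * c powr - (p / q)"
  have "y powr p \<le> ?m t"
    if t: "t \<in> {a..b}" and y: "0 \<le> y" "ennreal y \<le> (\<integral>\<^sup>+s. ennreal (RL_kernel \<alpha> t s * g s) \<partial>lborel)" for t y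
  proof -
    have "(\<integral>\<^sup>+s. ennreal ((RL_kernel \<alpha> t s * indicator {a..} s) powr q) \<partial>lborel)
        = (\<integral>\<^sup>+s. ennreal ((t - s) powr ((\<alpha> - 1) * q)) * indicator {a..t} s \<partial>lborel)"
      using q1 by (intro nn_integral_cong) (auto simp: RL_kernel_powr powr_mult split: split_indicator)
    also have "\<dots> = ennreal ((t - a) powr c / c)"
      using t c nn_integral_powr_to_right_end[of a t "(\<alpha> - 1) * q"] by (simp add: c_def)
    finally have K: "(\<integral>\<^sup>+s. ennreal ((RL_kernel \<alpha> t s * indicator {a..} s) powr q) \<partial>lborel) = ennreal ((t - a) powr c / c)" .
    note y(2)
    also have "(\<integral>\<^sup>+s. ennreal (RL_kernel \<alpha> t s * g s) \<partial>lborel)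
        = (\<integral>\<^sup>+s. ennreal (g s * (RL_kernel \<alpha> t s * indicator {a..} s)) \<partial>lborel)"
      using g(3) by (intro nn_integral_cong) (auto simp: mult.commute split: split_indicator)
    also have "\<dots> \<le> ennreal (1 powr (1 / p) * ((t - a) powr c / c) powr (1 / q))"
      using g K c q1 assms(3) RL_kernel_nonneg by (intro nn_integral_Holder) auto
    finally have "y \<le> ((t - a) powr c / c) powr (1 / q)" by simp
    then have "y powr p \<le> (((t - a) powr c / c) powr (1 / q)) powr p"
      using y assms(3) by (intro powr_mono2) auto
    also have "\<dots> = ?m t"
      using c t by (simp add: powr_powr powr_divide powr_minus divide_simps)
    finally show ?thesis .
  qed
  moreover have "(\<integral>\<^sup>+t. ennreal (?m t) * indicator {a..b} t \<partial>lborel) = ennreal (?C powr p)"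
  proof -
    have "(\<integral>\<^sup>+t. ennreal (?m t) * indicator {a..b} t \<partial>lborel)
       = (\<integral>\<^sup>+t. ennreal (c powr - (p / q)) * (ennreal ((t - a) powr (\<alpha> * p - 1)) * indicator {a..b} t) \<partial>lborel)"
      unfolding e by (intro nn_integral_cong) (auto simp: ennreal_mult mult_ac)
    also have "\<dots> = ennreal (c powr - (p / q)) * ennreal ((b - a) powr (\<alpha> * p) / (\<alpha> * p))"
      using ab assms(2,3) nn_integral_powr_from_left_end[of a b "\<alpha> * p - 1"] by (simp add: nn_integral_cmult)
    also have "\<dots> = ennreal (?C powr p)"
      using ab assms(2,3) c
      by (simp add: ennreal_mult[symmetric] powr_divide powr_mult powr_powr powr_minus divide_simps)
    finally show ?thesis .
  qed
  ultimately show "\<exists>H \<in> borel_measurable borel. (\<integral>\<^sup>+t. H t * indicator {a..b} t \<partial>lborel) \<le> ennreal (?C powr p) \<and>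
      (\<forall>t\<in>{a..b}. \<forall>y\<ge>0. ennreal y \<le> (\<integral>\<^sup>+s. ennreal (RL_kernel \<alpha> t s * g s) \<partial>lborel) \<longrightarrow> ennreal (y powr p) \<le> H t)"
    by (intro bexI[of _ "\<lambda>t. ennreal (?m t)"]) (auto simp: ennreal_leI)
qed (rule assms)+

text \<open>Minkowski's integral inequality bounds the \<open>L\<^sup>p\<close> norm of \<open>t \<mapsto> \<integral> k t s * g s ds\<close> by \<open>\<integral> g s * K s ds\<close>,
where \<open>K s\<close> is the \<open>L\<^sup>p\<close> norm of the kernel \<open>k\<close> in \<open>t\<close>, and Hoelder's inequality bounds the latter
integral by \<open>D\<close>, the \<open>L\<^sup>q\<close> norm of \<open>K\<close>. The instance of Minkowski's inequality is derived directly: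
by Hoelder's inequality for the measure \<open>g K ds\<close> of total mass at most \<open>D\<close>, applied to \<open>k / K\<close>, the
\<open>p\<close>-th power of the inner integral is at most \<open>D\<^bsup>p-1\<^esup> \<integral> (k / K)\<^sup>p g K ds\<close>. By Tonelli's theorem
the integral of this over \<open>t\<close> is \<open>D\<^bsup>p-1\<^esup> \<integral> g K ds \<le> D\<^sup>p\<close>.\<close>
lemma RL_opnorm_le_fixed_source:
  fixes a b \<alpha> p q :: real
  assumes ab: "a < b" and "0 < \<alpha>" "1 < p" and q: "q = p / (p - 1)" and "1 / q < \<alpha>"
  shows "RL_opnorm TYPE('x::banach) a b \<alpha> p \<le>
    ennreal ((b - a) powr \<alpha> / (((\<alpha> - 1) * p + 1) powr (1 / p) * (\<alpha> * q) powr (1 / q)) / Gamma \<alpha>)"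
proof -
  define c where "c = (\<alpha> - 1) * p + 1"
  have q1: "1 < q" "1 / p + 1 / q = 1" "p / q = p - 1" "q / p = q - 1" "q * (p - 1) = p"
    using assms(3) unfolding q by (auto simp: field_simps)
  then have pq: "1 / q = 1 - 1 / p" by simp
  have c: "0 < c" using assms(3,5) unfolding c_def pq by (simp add: field_simps)
  define D where "D = (b - a) powr \<alpha> / (c powr (1 / p) * (\<alpha> * q) powr (1 / q))"
  have D: "0 < D" using assms c q1 by (simp add: D_def)
  have "RL_opnorm TYPE('x) a b \<alpha> p \<le> ennreal (D / Gamma \<alpha>)"
  proof (rule RL_opnorm_leI)
    fix g :: "real \<Rightarrow> real"
    assume g: "g \<in> borel_measurable borel" "\<And>x. 0 \<le> g x" "\<And>x. x \<notin> {a..b} \<Longrightarrow> g x = 0"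
      "(\<integral>\<^sup>+x. ennreal (g x powr p) \<partial>lborel) \<le> 1"
    note [measurable] = g(1)
    define K where "K s = ((b - s) powr c / c) powr (1 / p)" for s
    have [measurable]: "K \<in> borel_measurable borel" unfolding K_def by measurable
    have K0: "0 \<le> K s" for s by (simp add: K_def)
    have Kp: "(\<integral>\<^sup>+t. ennreal (RL_kernel \<alpha> t s powr p) * indicator {a..b} t \<partial>lborel) = ennreal (K s powr p)"
      if "s \<in> {a..b}" for s
    proof -
      have "(\<integral>\<^sup>+t. ennreal (RL_kernel \<alpha> t s powr p) * indicator {a..b} t \<partial>lborel)
        = (\<integral>\<^sup>+t. ennreal ((t - s) powr ((\<alpha> - 1) * p)) * indicator {s..b} t \<partial>lborel)"
        using assms(3) that by (intro nn_integral_cong) (auto simp: RL_kernel_powr split: split_indicator)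
      also have "\<dots> = ennreal ((b - s) powr c / c)"
        using c that nn_integral_powr_from_left_end[of s b "(\<alpha> - 1) * p"] by (simp add: c_def)
      also have "(b - s) powr c / c = K s powr p"
        using assms(3) c by (simp add: K_def powr_powr)
      finally show ?thesis .
    qed
    have Kq: "(\<integral>\<^sup>+s. ennreal ((K s * indicator {a..b} s) powr q) \<partial>lborel) = ennreal (D powr q)"
    proof -
      have e: "c * (q / p) = \<alpha> * q - 1"
      proof -
        have "c * (q / p) = (\<alpha> - 1) * (p * (q - 1)) + (q - 1)"
          by (simp add: c_def q1(4) distrib_right)
        also have "p * (q - 1) = q" using q1(5) by (simp add: algebra_simps)
        finally show ?thesis by (simp add: left_diff_distrib)
      qed
      have "(\<integral>\<^sup>+s. ennreal ((K s * indicator {a..b} s) powr q) \<partial>lborel)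
         = (\<integral>\<^sup>+s. ennreal (c powr - (q / p)) * (ennreal ((b - s) powr (\<alpha> * q - 1)) * indicator {a..b} s) \<partial>lborel)"
        unfolding e[symmetric] using c
        by (intro nn_integral_cong)
           (auto simp: K_def powr_powr powr_divide powr_minus divide_simps ennreal_mult[symmetric] split: split_indicator)
      also have "\<dots> = ennreal (c powr - (q / p)) * ennreal ((b - a) powr (\<alpha> * q) / (\<alpha> * q))"
        using ab assms(2) q1 nn_integral_powr_to_right_end[of a b "\<alpha> * q - 1"] by (simp add: nn_integral_cmult)
      also have "\<dots> = ennreal (D powr q)"
        using ab assms(2) q1(1) c unfolding D_def
        by (simp add: ennreal_mult[symmetric] powr_divide powr_mult powr_powr powr_minus divide_simps)
      finally show ?thesis .
    qed
    have gK: "(\<integral>\<^sup>+s. ennreal (g s * K s) \<partial>lborel) \<le> ennreal D"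
    proof -
      have "(\<integral>\<^sup>+s. ennreal (g s * K s) \<partial>lborel) = (\<integral>\<^sup>+s. ennreal (g s * (K s * indicator {a..b} s)) \<partial>lborel)"
        using g(3) by (intro nn_integral_cong) (auto split: split_indicator)
      also have "\<dots> \<le> ennreal (1 powr (1 / p) * (D powr q) powr (1 / q))"
        using g Kq K0 q1 assms(3) by (intro nn_integral_Holder) auto
      also have "\<dots> = ennreal D" using D q1 by (simp add: powr_powr)
      finally show ?thesis .
    qed
    \<comment> \<open>The power \<open>w\<^sup>p\<close> is \<open>(k / K)\<^sup>p g K\<close>, and \<open>w (g K)\<^bsup>1/q\<^esup> = k g\<close> because \<open>K s > 0\<close> for \<open>s < t \<le> b\<close>.\<close>
    define w where "w t s = RL_kernel \<alpha> t s * K s powr - (1 / q) * g s powr (1 / p)" for t s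
    have wp: "w t s powr p = RL_kernel \<alpha> t s powr p * (K s powr (1 - p) * g s)" for t s
      unfolding w_def using g(2)[of s] K0[of s] RL_kernel_nonneg[of \<alpha> t s] assms(3) q1(3)
      by (simp add: powr_mult powr_powr minus_divide_left[symmetric])
    have [measurable]: "(\<lambda>(t, s). w t s) \<in> borel_measurable (borel \<Otimes>\<^sub>M borel)"
      "w t \<in> borel_measurable borel" for t
      unfolding w_def split_beta by measurable
    let ?A = "\<lambda>t. \<integral>\<^sup>+s. ennreal (w t s powr p) \<partial>lborel"
    have "ennreal (y powr p) \<le> ennreal (D powr (p - 1)) * ?A t"
      if t: "t \<in> {a..b}" and y: "0 \<le> y" "ennreal y \<le> (\<integral>\<^sup>+s. ennreal (RL_kernel \<alpha> t s * g s) \<partial>lborel)" for t y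
    \<comment> \<open>Where the majorant is infinite there is nothing to prove.\<close>
    proof (cases "?A t")
      case top
      then show ?thesis using D by (simp add: ennreal_mult_top)
    next
      case (real A)
      have split: "RL_kernel \<alpha> t s * g s = w t s * (K s * g s) powr (1 / q)" for s
      proof (cases "s < t")
        case True
        then have "0 < K s" using t c by (simp add: K_def)
        moreover have "g s = g s powr (1 / p) * g s powr (1 / q)"
          using g(2)[of s] q1(2) by (simp add: powr_add[symmetric])
        ultimately show ?thesis unfolding w_def using K0[of s] g(2)[of s] by (simp add: powr_mult powr_minus field_simps)
      next
        case False
        then show ?thesis by (simp add: w_def RL_kernel_def)
      qed
      note y(2)
      also have "(\<integral>\<^sup>+s. ennreal (RL_kernel \<alpha> t s * g s) \<partial>lborel) = (\<integral>\<^sup>+s. ennreal (w t s * (K s * g s) powr (1 / q)) \<partial>lborel)"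
        by (simp add: split)
      also have "\<dots> \<le> ennreal (A powr (1 / p) * D powr (1 / q))"
      proof (rule nn_integral_Holder)
        show "(\<integral>\<^sup>+s. ennreal (((K s * g s) powr (1 / q)) powr q) \<partial>lborel) \<le> ennreal D"
          using gK q1(1) g(2) K0 by (simp add: powr_powr mult.commute)
      qed (use real D q1 assms(3) g(2) K0 RL_kernel_nonneg in \<open>auto simp: w_def\<close>)
      finally have "y \<le> A powr (1 / p) * D powr (1 / q)" by simp
      then have "y powr p \<le> (A powr (1 / p) * D powr (1 / q)) powr p"
        using y assms(3) by (intro powr_mono2) auto
      also have "\<dots> = D powr (p - 1) * A"
        using real(1) D assms(3) q1(3) by (simp add: powr_mult powr_powr)
      finally show ?thesis using real by (simp add: ennreal_mult[symmetric] ennreal_leI)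
    qed
    moreover have "(\<integral>\<^sup>+t. (ennreal (D powr (p - 1)) * ?A t) * indicator {a..b} t \<partial>lborel) \<le> ennreal (D powr p)"
    proof -
      have "(\<integral>\<^sup>+t. (ennreal (D powr (p - 1)) * ?A t) * indicator {a..b} t \<partial>lborel)
        = ennreal (D powr (p - 1)) * (\<integral>\<^sup>+t. \<integral>\<^sup>+s. ennreal (w t s powr p) * indicator {a..b} t \<partial>lborel \<partial>lborel)"
        by (simp add: nn_integral_cmult nn_integral_multc mult.assoc)
      also have "(\<integral>\<^sup>+t. \<integral>\<^sup>+s. ennreal (w t s powr p) * indicator {a..b} t \<partial>lborel \<partial>lborel)
        = (\<integral>\<^sup>+s. \<integral>\<^sup>+t. ennreal (w t s powr p) * indicator {a..b} t \<partial>lborel \<partial>lborel)"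
        by (rule lborel_pair.Fubini') simp
      also have "\<dots> = (\<integral>\<^sup>+s. ennreal (g s * K s) \<partial>lborel)"
      proof (rule nn_integral_cong)
        fix s
        have "(\<integral>\<^sup>+t. ennreal (w t s powr p) * indicator {a..b} t \<partial>lborel)
          = (\<integral>\<^sup>+t. ennreal (K s powr (1 - p) * g s) * (ennreal (RL_kernel \<alpha> t s powr p) * indicator {a..b} t) \<partial>lborel)"
          unfolding wp using g(2) by (intro nn_integral_cong) (simp add: ennreal_mult mult_ac)
        also have "\<dots> = ennreal (K s powr (1 - p) * g s) * (\<integral>\<^sup>+t. ennreal (RL_kernel \<alpha> t s powr p) * indicator {a..b} t \<partial>lborel)"
          by (simp add: nn_integral_cmult)
        also have "\<dots> = ennreal (g s * K s)"
        proof (cases "s \<in> {a..b}")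
          case True
          have "K s powr (1 - p) * K s powr p = K s"
            using K0[of s] by (simp add: powr_add[symmetric])
          then have eq: "K s powr (1 - p) * g s * K s powr p = g s * K s"
            by (metis mult.assoc mult.commute)
          have "ennreal (K s powr (1 - p) * g s) * ennreal (K s powr p)
              = ennreal (K s powr (1 - p) * g s * K s powr p)"
            using g(2)[of s] by (simp add: ennreal_mult)
          then show ?thesis by (simp only: Kp[OF True] eq)
        qed (simp add: g(3))
        finally show "(\<integral>\<^sup>+t. ennreal (w t s powr p) * indicator {a..b} t \<partial>lborel) = ennreal (g s * K s)" .
      qed
      also have "ennreal (D powr (p - 1)) * \<dots> \<le> ennreal (D powr (p - 1)) * ennreal D"
        by (intro mult_left_mono gK) auto
      also have "\<dots> = ennreal (D powr p)"
        using D by (simp add: ennreal_mult[symmetric] powr_diff)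
      finally show ?thesis .
    qed
    ultimately show "\<exists>H \<in> borel_measurable borel. (\<integral>\<^sup>+t. H t * indicator {a..b} t \<partial>lborel) \<le> ennreal (D powr p) \<and>
        (\<forall>t\<in>{a..b}. \<forall>y\<ge>0. ennreal y \<le> (\<integral>\<^sup>+s. ennreal (RL_kernel \<alpha> t s * g s) \<partial>lborel) \<longrightarrow> ennreal (y powr p) \<le> H t)"
      by (intro bexI[of _ "\<lambda>t. ennreal (D powr (p - 1)) * ?A t"] conjI ballI allI impI) (assumption | simp)+
  qed (use assms(2,3) D in auto)
  then show ?thesis by (simp add: D_def c_def)
qed

section \<open>Operator norm bounds and their comparison\<close>

theorem theorem43:
  fixes t0 t1 \<alpha> p q :: real
  assumes "t0 < t1" and "0 < \<alpha>" and "\<alpha> < 1" and "1 < p" and "q = p / (p - 1)"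
  shows
    "(\<alpha> > 1 / q \<longrightarrow>
        RL_opnorm TYPE('x::banach) t0 t1 \<alpha> p
          \<le> ennreal ((t1 - t0) powr \<alpha> /
              (Gamma \<alpha> * ((\<alpha> - 1) * p + 1) powr (1 / p) * (\<alpha> * q) powr (1 / q))) \<and>
        (p < p1 \<alpha> \<longrightarrow>
          (t1 - t0) powr \<alpha> /
              (Gamma \<alpha> * ((\<alpha> - 1) * p + 1) powr (1 / p) * (\<alpha> * q) powr (1 / q))
            < (t1 - t0) powr \<alpha> / Gamma (\<alpha> + 1)) \<and>
        (p \<ge> p1 \<alpha> \<longrightarrow>
          (t1 - t0) powr \<alpha> / Gamma (\<alpha> + 1)
            \<le> (t1 - t0) powr \<alpha> /
                (Gamma \<alpha> * ((\<alpha> - 1) * p + 1) powr (1 / p) * (\<alpha> * q) powr (1 / q)))) \<and>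
     (\<alpha> > 1 / p \<longrightarrow>
        RL_opnorm TYPE('x) t0 t1 \<alpha> p
          \<le> ennreal ((t1 - t0) powr \<alpha> /
              (Gamma \<alpha> * ((\<alpha> - 1) * q + 1) powr (1 / q) * (\<alpha> * p) powr (1 / p))) \<and>
        (p > p2 \<alpha> \<longrightarrow>
          (t1 - t0) powr \<alpha> /
              (Gamma \<alpha> * ((\<alpha> - 1) * q + 1) powr (1 / q) * (\<alpha> * p) powr (1 / p))
            < (t1 - t0) powr \<alpha> / Gamma (\<alpha> + 1)) \<and>
        (p \<le> p2 \<alpha> \<longrightarrow>
          (t1 - t0) powr \<alpha> / Gamma (\<alpha> + 1)
            \<le> (t1 - t0) powr \<alpha> /
                (Gamma \<alpha> * ((\<alpha> - 1) * q + 1) powr (1 / q) * (\<alpha> * p) powr (1 / p))))"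
proof -
  have q: "1 < q" "q / (q - 1) = p"
    using conjugate_exponent[OF assms(4)] by (simp_all add: assms(5))
  have T: "0 < t1 - t0" using assms(1) by simp
  have i: "p < p1 \<alpha> \<longleftrightarrow> (t1 - t0) powr \<alpha> / (Gamma \<alpha> * ((\<alpha> - 1) * p + 1) powr (1 / p) * (\<alpha> * q) powr (1 / q))
      < (t1 - t0) powr \<alpha> / Gamma (\<alpha> + 1)" if "1 / q < \<alpha>"
    using bound_less_iff_eta_less[OF T assms(2,4,5) that] less_p1_iff[OF assms(2-4)] by blast
  have ii: "p2 \<alpha> < p \<longleftrightarrow> (t1 - t0) powr \<alpha> / (Gamma \<alpha> * ((\<alpha> - 1) * q + 1) powr (1 / q) * (\<alpha> * p) powr (1 / p))
      < (t1 - t0) powr \<alpha> / Gamma (\<alpha> + 1)" if "1 / p < \<alpha>"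
    using bound_less_iff_eta_less[OF T assms(2) q(1) q(2)[symmetric] that] less_p1_iff[OF assms(2,3) q(1)]
      p2_less_iff[OF assms(2-4)] unfolding assms(5)[symmetric] by blast
  have N1: "RL_opnorm TYPE('x) t0 t1 \<alpha> p \<le> ennreal ((t1 - t0) powr \<alpha> /
      (Gamma \<alpha> * ((\<alpha> - 1) * p + 1) powr (1 / p) * (\<alpha> * q) powr (1 / q)))" if "1 / q < \<alpha>"
    using RL_opnorm_le_fixed_source[OF assms(1,2,4,5) that, where 'x = 'x]
    by (simp only: divide_divide_eq_left mult_ac)
  have N2: "RL_opnorm TYPE('x) t0 t1 \<alpha> p \<le> ennreal ((t1 - t0) powr \<alpha> /
      (Gamma \<alpha> * ((\<alpha> - 1) * q + 1) powr (1 / q) * (\<alpha> * p) powr (1 / p)))" if "1 / p < \<alpha>"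
    using RL_opnorm_le_fixed_time[OF assms(1,2,4,5) that, where 'x = 'x]
    by (simp only: divide_divide_eq_left mult_ac)
  show ?thesis
    using i ii N1 N2 by (meson not_less)
qed

end
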